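(* Let $q$ be a prime power and let $n=p_1^{e_1}p_2^{e_2}\cdots p_s^{e_s}$ be the complete factorization of $n\in\mathbb{N}$ into powers of distinct primes, with $\gcd(n,q)=1$. Let $\Phi_{p_1^{e_1}}=\prod_i f_{1_i}$, $\Phi_{p_2^{e_2}}=\prod_j f_{2_j}$, $\dots$, $\Phi_{p_s^{e_s}}=\prod_k f_{s_k}$ be the corresponding factorizations into monic irreducible polynomials over $\mathbb{F}_q$. Then $$\Phi_n=\Phi_{p_1^{e_1}}\odot\Phi_{p_2^{e_2}}\odot\cdots\odot\Phi_{p_s^{e_s}}=\prod_i\prod_j\cdots\prod_k\left(f_{1_i}\odot f_{2_j}\odot\cdots\odot f_{s_k}\right).$$ Moreover, if the multiplicative orders of $q$ modulo the prime powers $p_i^{e_i}$, $1\le i\le s$, are pairwise coprime, then this is the complete factorization of $\Phi_n$ over $\mathbb{F}_q$ (i.e. all the factors $f_{1_i}\odot f_{2_j}\odot\cdots\odot f_{s_k}$ are irreducible over $\mathbb{F}_q$).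
   Context: $\Phi_m$ denotes the $m$-th cyclotomic polynomial, regarded over $\mathbb{F}_q$. For polynomials $f,g$ over $\mathbb{F}_q$ with nonzero roots in the algebraic closure, the composed multiplication is $(f\odot g)(x)=\prod_{\alpha}\prod_{\beta}(x-\alpha\beta)$, where $\alpha$ runs over the roots of $f$ and $\beta$ over the roots of $g$ (with multiplicity); it is an associative and commutative operation with values in monic polynomials over $\mathbb{F}_q$. *)

theory Defs
  imports
    Complex_Main
    "HOL-Library.FuncSet"
    "HOL-Algebra.Algebraic_Closure_Type"
    "HOL-Number_Theory.Number_Theory"
    "HOL-Computational_Algebra.Computational_Algebra"
begin

definition primitive_unity_root :: "nat \<Rightarrow> complex \<Rightarrow> bool" where
  "primitive_unity_root n z \<longleftrightarrow> n > 0 \<and> z ^ n = 1 \<and> (\<forall>k. 0 < k \<and> k < n \<longrightarrow> z ^ k \<noteq> 1)"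

(* The complex product over the primitive n-th roots of unity has integer coefficients for every
   n > 0, and of_int is injective on coefficients, so the description below is proper. *)
definition cyclotomic_int :: "nat \<Rightarrow> int poly" where
  "cyclotomic_int n =
     (THE P. map_poly of_int P = (\<Prod>z | primitive_unity_root n z. [:- z, 1:]))"

(* The n-th cyclotomic polynomial regarded over the ring 'a. *)
definition cyclotomic :: "nat \<Rightarrow> 'a :: comm_ring_1 poly" where
  "cyclotomic n = map_poly of_int (cyclotomic_int n)"

definition ac_roots :: "'a :: field poly \<Rightarrow> 'a alg_closure multiset" where
  "ac_roots f = proots (map_poly to_ac f)"

(* The double product lives over the algebraic closure, but over a finite field its coefficients
   are fixed by the Frobenius map, i.e. they lie in the range of to_ac; of_ac, the inverse of
   to_ac on that range, takes it back to the base field. *)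
definition composed_mult :: "'a :: field poly \<Rightarrow> 'a poly \<Rightarrow> 'a poly" where
  "composed_mult f g = map_poly of_ac (\<Prod>\<alpha>\<in>#ac_roots f. \<Prod>\<beta>\<in>#ac_roots g. [:- (\<alpha> * \<beta>), 1:])"

(* The empty composition is X - 1, the neutral element of composed multiplication on monic
   polynomials; for nonempty lists no neutral element is involved. *)
fun composed_mult_list :: "'a :: field poly list \<Rightarrow> 'a poly" where
  "composed_mult_list [] = [:- 1, 1:]"
| "composed_mult_list [f] = f"
| "composed_mult_list (f # g # hs) = composed_mult f (composed_mult_list (g # hs))"

end

theory Submission
  imports Defs
begin

text \<open>
  A monic polynomial over the field with \<open>q\<close> elements is determined by its multiset of roots in
  the algebraic closure, and the multisets that occur are those stable under the Frobenius map
  \<open>x \<mapsto> x ^ q\<close>. Composed multiplication becomes the product of multisets, which is associative,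
  distributes over sums, and multiplies primitive \<open>m\<close>-th with primitive \<open>n\<close>-th roots of unity
  bijectively onto primitive \<open>m * n\<close>-th ones when \<open>m\<close> and \<open>n\<close> are coprime. This gives both
  equations. A monic polynomial is irreducible iff its roots are simple and form one Frobenius
  orbit; when the orbit lengths of two factors are coprime, the Chinese remainder theorem makes
  the products of their roots a single orbit again.
\<close>

subsection \<open>Polynomials with prescribed roots\<close>

text \<open>Over an algebraically closed field this is inverse to \<open>proots\<close> on monic
  polynomials, so equations between monic polynomials become equations between multisets.\<close>

definition root_poly :: "'b::field multiset \<Rightarrow> 'b poly" where
  "root_poly A = (\<Prod>x\<in>#A. [:- x, 1:])"

lemma root_poly_empty [simp]: "root_poly {#} = 1"
  and root_poly_add_mset [simp]: "root_poly (add_mset x A) = [:- x, 1:] * root_poly A"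
  and root_poly_union: "root_poly (A + B) = root_poly A * root_poly B"
  by (simp_all add: root_poly_def)

lemma root_poly_nonzero [simp]: "root_poly A \<noteq> 0"
  by (induction A) (simp_all del: mult_pCons_left)

lemma lead_coeff_root_poly [simp]: "Polynomial.lead_coeff (root_poly A) = 1"
  by (induction A) (simp_all only: root_poly_empty root_poly_add_mset lead_coeff_mult, simp_all)

lemma proots_root_poly [simp]: "proots (root_poly A) = A"
  by (induction A) (simp_all del: mult_pCons_left add: proots_mult)

lemma root_poly_proots:
  fixes p :: "'b::alg_closed_field poly"
  assumes "Polynomial.lead_coeff p = 1"
  shows "root_poly (proots p) = p"
proof -
  have "p \<noteq> 0" using assms by auto
  from alg_closed_imp_factorization[OF this] obtain A where "p = root_poly A"
    unfolding root_poly_def using assms by auto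
  then show ?thesis by simp
qed

lemma root_poly_mset_set: "root_poly (mset_set S) = (\<Prod>x\<in>S. [:- x, 1:])"
  by (simp add: root_poly_def prod_unfold_prod_mset)

section \<open>Ring homomorphisms applied to coefficients\<close>

locale ring_morphism =
  fixes h :: "'b::comm_ring_1 \<Rightarrow> 'c::comm_ring_1"
  assumes hom_one [simp]: "h 1 = 1"
    and hom_add: "h (x + y) = h x + h y"
    and hom_mult: "h (x * y) = h x * h y"
begin

lemma hom_zero [simp]: "h 0 = 0"
  using hom_add[of 0 0] by simp

lemma hom_uminus: "h (- x) = - h x"
  using hom_add[of x "- x"] by (simp add: eq_neg_iff_add_eq_0 add.commute)

lemma hom_sum: "h (sum g I) = (\<Sum>i\<in>I. h (g i))"
  by (induction I rule: infinite_finite_induct) (simp_all add: hom_add)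

lemma map_poly_hom_add: "map_poly h (p + r) = map_poly h p + map_poly h r"
  by (intro poly_eqI) (simp add: coeff_map_poly hom_add)

lemma map_poly_hom_uminus: "map_poly h (- p) = - map_poly h p"
  by (intro poly_eqI) (simp add: coeff_map_poly hom_uminus)

lemma map_poly_hom_diff: "map_poly h (p - r) = map_poly h p - map_poly h r"
  using map_poly_hom_add[of p "- r"] by (simp add: map_poly_hom_uminus)

lemma map_poly_hom_mult: "map_poly h (p * r) = map_poly h p * map_poly h r"
  by (intro poly_eqI) (simp add: coeff_map_poly coeff_mult hom_sum hom_mult)

lemma map_poly_hom_prod: "map_poly h (\<Prod>i\<in>I. g i) = (\<Prod>i\<in>I. map_poly h (g i))"
  by (induction I rule: infinite_finite_induct) (simp_all add: map_poly_hom_mult)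

text \<open>The leading coefficient 1 goes to 1 and not to 0, so the degree survives even when
  \<open>h\<close> kills other coefficients, as \<open>of_int\<close> does in positive
  characteristic.\<close>

lemma map_poly_hom_monic:
  assumes "Polynomial.lead_coeff p = 1"
  shows "Polynomial.lead_coeff (map_poly h p) = 1" "Polynomial.degree (map_poly h p) = Polynomial.degree p"
proof -
  show "Polynomial.degree (map_poly h p) = Polynomial.degree p"
    by (rule map_poly_degree_eq) (simp add: assms)
  then show "Polynomial.lead_coeff (map_poly h p) = 1"
    by (simp add: coeff_map_poly assms)
qed

end

lemma map_poly_root_poly:
  assumes "ring_morphism h"
  shows "map_poly h (root_poly A) = root_poly (image_mset h A)"
proof -
  interpret ring_morphism h by fact
  show ?thesis
    by (induction A)
       (simp_all del: mult_pCons_left add: map_poly_hom_mult map_poly_pCons hom_uminus)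
qed

lemma map_poly_inject:
  assumes "inj h" "h 0 = 0" "map_poly h p = map_poly h r"
  shows "p = r"
  using assms by (metis coeff_map_poly injD poly_eqI)

lemma ring_morphism_of_int: "ring_morphism (of_int :: int \<Rightarrow> 'b::comm_ring_1)"
  by unfold_locales simp_all

lemma ring_morphism_to_ac: "ring_morphism to_ac"
  by unfold_locales simp_all

subsection \<open>Cyclotomic polynomials\<close>

text \<open>Exact order as a divisibility condition, in any field: questions about powers become
  questions about divisors. For \<open>n = 0\<close> the condition alone would describe elements of
  infinite order, which \<open>n > 0\<close> excludes.\<close>

definition primitive_roots :: "nat \<Rightarrow> 'b::field set" where
  "primitive_roots n = {z. n > 0 \<and> (\<forall>k. z ^ k = 1 \<longleftrightarrow> n dvd k)}"

lemma primitive_roots_iff: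
  "z \<in> primitive_roots n \<longleftrightarrow> n > 0 \<and> z ^ n = 1 \<and> (\<forall>k. 0 < k \<and> k < n \<longrightarrow> z ^ k \<noteq> 1)"
  (is "?L \<longleftrightarrow> ?R")
proof
  assume ?L
  then show ?R by (auto simp: primitive_roots_def dest: dvd_imp_le)
next
  assume R: ?R
  have "n dvd k" if "z ^ k = 1" for k
  proof -
    have "z ^ k = z ^ (n * (k div n) + k mod n)" by simp
    also have "\<dots> = z ^ (k mod n)" using R by (simp only: power_add power_mult) simp
    finally have "z ^ (k mod n) = 1" using that by simp
    moreover have "k mod n < n" using R by simp
    ultimately have "k mod n = 0" using R by (cases "k mod n = 0") auto
    then show ?thesis by auto
  qed
  then show ?L using R by (auto simp: primitive_roots_def power_mult elim!: dvdE)
qed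

lemma primitive_roots_1 [simp]: "primitive_roots (Suc 0) = {1}"
  by (auto simp: primitive_roots_iff)

lemma primitive_unity_root_eq: "{z. primitive_unity_root n z} = primitive_roots n"
  by (auto simp: primitive_unity_root_def primitive_roots_iff)

lemma primitive_rootsD: "z \<in> primitive_roots n \<Longrightarrow> z ^ k = 1 \<longleftrightarrow> n dvd k"
  by (simp add: primitive_roots_def)

lemma finite_roots_of_unity:
  assumes "n > 0"
  shows "finite {z::'b::field. z ^ n = 1}"
proof (rule finite_subset)
  let ?p = "Polynomial.monom 1 n - 1 :: 'b poly"
  have "coeff ?p n \<noteq> 0" using assms by simp
  then have "?p \<noteq> 0" by force
  then show "finite {z. poly ?p z = 0}" by (rule poly_roots_finite)
qed (auto simp: poly_monom)

lemma finite_primitive_roots [simp]: "finite (primitive_roots n :: 'b::field set)"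
proof (cases "n > 0")
  case True
  show ?thesis
    by (rule finite_subset[OF _ finite_roots_of_unity[OF True]]) (auto simp: primitive_roots_iff)
qed (simp add: primitive_roots_def)

lemma primitive_roots_disjoint:
  "m \<noteq> n \<Longrightarrow> primitive_roots m \<inter> primitive_roots n = ({} :: 'b::field set)"
  by (auto simp: primitive_roots_def) (metis dvd_antisym dvd_refl)

text \<open>An \<open>n\<close>-th root of unity has a least positive exponent \<open>d\<close>
  sending it to 1, and this exact order divides \<open>n\<close>.\<close>

lemma UN_primitive_roots:
  assumes "n > 0"
  shows "(\<Union>d\<in>{d. d dvd n}. primitive_roots d) = {z::'b::field. z ^ n = 1}"
proof (intro equalityI subsetI)
  fix z :: 'b assume z: "z \<in> {z. z ^ n = 1}"
  then have ex: "\<exists>k>0. z ^ k = 1" using assms by auto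
  define d where "d = (LEAST k. k > 0 \<and> z ^ k = 1)"
  have "d > 0 \<and> z ^ d = 1" using LeastI_ex[OF ex] by (simp add: d_def)
  moreover have "z ^ k \<noteq> 1" if "0 < k" "k < d" for k
    using not_less_Least[of k "\<lambda>k. k > 0 \<and> z ^ k = 1"] that by (simp add: d_def)
  ultimately have "z \<in> primitive_roots d" by (simp add: primitive_roots_iff)
  moreover from this have "d dvd n" using z by (simp add: primitive_rootsD)
  ultimately show "z \<in> (\<Union>d\<in>{d. d dvd n}. primitive_roots d)" by blast
qed (auto simp: primitive_rootsD)

text \<open>\<open>X ^ n - 1\<close> is separable when \<open>n\<close> is nonzero in the field, so
  it is the product of \<open>X - z\<close> over the distinct \<open>n\<close>-th roots of unity
  \<open>z\<close>. Grouping these by exact order gives the product over divisors.\<close>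

lemma prod_primitive_roots:
  fixes n :: nat
  assumes n: "of_nat n \<noteq> (0 :: 'b::alg_closed_field)"
  shows "(\<Prod>d | d dvd n. root_poly (mset_set (primitive_roots d))) = (Polynomial.monom 1 n - 1 :: 'b poly)"
proof -
  let ?p = "Polynomial.monom 1 n - 1 :: 'b poly"
  have n0: "n > 0" using n by (cases n) auto
  have lc: "coeff ?p n = 1" using n0 by simp
  have deg: "Polynomial.degree ?p = n"
    by (rule antisym, rule degree_diff_le) (simp_all add: degree_monom_le le_degree lc del: coeff_diff)
  have p0: "?p \<noteq> 0" using lc by force
  \<comment> \<open>Writing \<open>?p\<close> as \<open>X - z\<close> times \<open>r\<close>, the
    derivative at \<open>z\<close> is the value of \<open>r\<close> there. It equals
    \<open>n * z ^ (n - 1)\<close>, which is nonzero, so \<open>z\<close> is not a root of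
    \<open>r\<close>.\<close>
  have "Polynomial.order z ?p = 1" if z: "poly ?p z = 0" for z
  proof -
    from z obtain r where r: "?p = [:- z, 1:] * r" unfolding poly_eq_0_iff_dvd by (elim dvdE)
    have zn: "z ^ n = 1" using z by (simp add: poly_monom)
    then have "z \<noteq> 0" using n0 by (auto simp: power_0_left)
    have "poly (pderiv ?p) z = poly r z" unfolding r by (simp add: pderiv_mult pderiv_pCons del: mult_pCons_left)
    moreover have "poly (pderiv ?p) z = of_nat n * z ^ (n - 1)"
      by (simp add: pderiv_diff pderiv_monom poly_monom)
    ultimately have "poly r z \<noteq> 0" using n \<open>z \<noteq> 0\<close> by auto
    then have "Polynomial.order z r = 0" by (simp add: order_0I)
    moreover have "Polynomial.order z [:- z, 1:] = 1"
      by (metis count_proots proots_linear_factor add.inverse_inverse count_single pCons_eq_0_iff zero_neq_one)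
    ultimately show ?thesis using p0 unfolding r by (subst order_mult) auto
  qed
  then have "proots ?p = mset_set {z. z ^ n = 1}"
    using finite_roots_of_unity[OF n0, where 'b = 'b] p0
    by (intro multiset_eqI) (auto simp: count_mset_set' poly_monom intro!: order_0I)
  then have "?p = root_poly (mset_set {z. z ^ n = 1})"
    using root_poly_proots[of ?p] lc deg by simp
  also have "\<dots> = (\<Prod>x\<in>(\<Union>d\<in>{d. d dvd n}. primitive_roots d). [:- x, 1:])"
    by (simp add: root_poly_mset_set UN_primitive_roots[OF n0])
  also have "\<dots> = (\<Prod>d | d dvd n. root_poly (mset_set (primitive_roots d)))"
    unfolding root_poly_mset_set using n0 primitive_roots_disjoint
    by (intro prod.UNION_disjoint) auto
  finally show ?thesis ..
qed

section \<open>Integrality of cyclotomic polynomials and passage to other fields\<close>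

text \<open>Division with remainder by a monic polynomial stays within the integers, and the
  quotient over the complex numbers is unique: a nonzero \<open>C - ?h D\<close> would give the
  remainder degree at least that of \<open>Q\<close>.\<close>

lemma monic_factor_over_int:
  fixes C :: "complex poly"
  assumes Q: "Polynomial.lead_coeff Q = 1" and eq: "map_poly of_int Q * C = map_poly of_int P"
  shows "\<exists>D. C = map_poly of_int D"
proof -
  interpret ring_morphism "of_int :: int \<Rightarrow> complex" by (rule ring_morphism_of_int)
  let ?h = "map_poly (of_int :: int \<Rightarrow> complex)"
  have "Q \<noteq> 0" using Q by auto
  \<comment> \<open>Pseudo-division scales \<open>P\<close> by a power of the leading coefficient of
    \<open>Q\<close>; that being 1, it is ordinary division.\<close>
  obtain D S where DS: "pseudo_divmod P Q = (D, S)" by force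
  from pseudo_divmod[OF \<open>Q \<noteq> 0\<close> DS] Q
  have P: "P = Q * D + S" and S: "S = 0 \<or> Polynomial.degree S < Polynomial.degree Q" by auto
  have *: "?h Q * (C - ?h D) = ?h S"
    using eq by (simp add: P map_poly_hom_add map_poly_hom_mult algebra_simps)
  have "C - ?h D = 0"
  proof (rule ccontr)
    assume nz: "C - ?h D \<noteq> 0"
    have Q': "?h Q \<noteq> 0" using map_poly_hom_monic[OF Q] by auto
    have "Polynomial.degree Q \<le> Polynomial.degree (?h Q * (C - ?h D))"
      using nz Q' map_poly_hom_monic[OF Q] by (simp add: degree_mult_eq)
    moreover have "Polynomial.degree (?h S) \<le> Polynomial.degree S" by (rule map_poly_degree_leq)
    moreover have "S \<noteq> 0" using * nz Q' by auto
    ultimately show False using S * by simp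
  qed
  then show ?thesis by auto
qed

lemma lead_coeff_of_intD:
  assumes "Polynomial.lead_coeff (map_poly of_int P :: complex poly) = 1"
  shows "Polynomial.lead_coeff P = 1"
proof -
  have "Polynomial.degree (map_poly of_int P :: complex poly) = Polynomial.degree P"
    by (cases "P = 0") (auto intro!: map_poly_degree_eq)
  then show ?thesis using assms by (simp add: coeff_map_poly)
qed

text \<open>By induction the product over the proper divisors of \<open>n\<close> is integral and
  monic. The polynomial for \<open>n\<close> is the cofactor of this product in
  \<open>X ^ n - 1\<close>, hence integral.\<close>

lemma cyclotomic_int_exists:
  assumes "n > 0"
  shows "\<exists>P. map_poly of_int P = root_poly (mset_set (primitive_roots n :: complex set))"
  using assms
proof (induction n rule: less_induct)
  case (less n)
  interpret ring_morphism "of_int :: int \<Rightarrow> complex" by (rule ring_morphism_of_int)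
  let ?g = "\<lambda>d. root_poly (mset_set (primitive_roots d :: complex set))"
  let ?D = "{d. d dvd n} - {n}"
  have "\<exists>P. \<forall>d\<in>?D. map_poly of_int (P d) = ?g d"
    using less by (intro bchoice) (auto dest: dvd_imp_le intro!: less.IH intro: dvd_pos_nat)
  then obtain P where P: "\<And>d. d \<in> ?D \<Longrightarrow> map_poly of_int (P d) = ?g d" by blast
  have Q: "map_poly of_int (\<Prod>d\<in>?D. P d) = (\<Prod>d\<in>?D. ?g d)"
    by (simp add: map_poly_hom_prod P)
  have "(\<Prod>d | d dvd n. ?g d) = (\<Prod>d\<in>?D. ?g d) * ?g n"
    using less.prems by (subst prod.remove[of _ n]) (auto simp: mult.commute)
  then have "map_poly of_int (\<Prod>d\<in>?D. P d) * ?g n = map_poly of_int (Polynomial.monom 1 n - 1)"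
    using prod_primitive_roots[of n, where 'b = complex] less.prems
    by (simp add: Q map_poly_hom_diff map_poly_monom)
  moreover have "Polynomial.lead_coeff (\<Prod>d\<in>?D. P d) = 1"
    by (rule lead_coeff_of_intD) (simp add: Q lead_coeff_prod)
  ultimately show ?case using monic_factor_over_int by metis
qed

lemma map_poly_of_int_cyclotomic_int:
  assumes "n > 0"
  shows "map_poly of_int (cyclotomic_int n) = root_poly (mset_set (primitive_roots n :: complex set))"
proof -
  have "inj (of_int :: int \<Rightarrow> complex)" by (simp add: inj_def)
  then have "\<exists>!P. map_poly of_int P = root_poly (mset_set (primitive_roots n :: complex set))"
    using cyclotomic_int_exists[OF assms] map_poly_inject[of "of_int :: int \<Rightarrow> complex"]
    by (metis of_int_0)
  from theI'[OF this] show ?thesis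
    unfolding cyclotomic_int_def primitive_unity_root_eq root_poly_mset_set .
qed

text \<open>Proved over the complex numbers and pulled back, the identity can then be mapped into
  any commutative ring. This is the bridge from the complex definition to positive
  characteristic.\<close>

lemma prod_cyclotomic_int:
  assumes "n > 0"
  shows "(\<Prod>d | d dvd n. cyclotomic_int d) = Polynomial.monom 1 n - 1"
proof -
  interpret ring_morphism "of_int :: int \<Rightarrow> complex" by (rule ring_morphism_of_int)
  have "map_poly of_int (\<Prod>d | d dvd n. cyclotomic_int d) =
      (\<Prod>d | d dvd n. root_poly (mset_set (primitive_roots d :: complex set)))"
    using assms by (auto simp: map_poly_hom_prod intro!: prod.cong map_poly_of_int_cyclotomic_int intro: dvd_pos_nat)
  also have "\<dots> = map_poly of_int (Polynomial.monom 1 n - 1)"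
    using assms by (simp add: prod_primitive_roots map_poly_hom_diff map_poly_monom)
  finally show ?thesis
    by (intro map_poly_inject[of "of_int :: int \<Rightarrow> complex"]) (auto simp: inj_def)
qed

lemma cyclotomic_int_monic:
  assumes "n > 0"
  shows "Polynomial.lead_coeff (cyclotomic_int n) = 1"
  using assms by (intro lead_coeff_of_intD) (simp add: map_poly_of_int_cyclotomic_int)

text \<open>Both sides have product \<open>X ^ n - 1\<close> over the divisors of \<open>n\<close>;
  by induction they agree at proper divisors, and the nonzero product over these cancels.\<close>

lemma cyclotomic_alg_closed:
  assumes "of_nat n \<noteq> (0 :: 'b::alg_closed_field)"
  shows "cyclotomic n = root_poly (mset_set (primitive_roots n :: 'b set))"
  using assms
proof (induction n rule: less_induct)
  case (less n)
  interpret ring_morphism "of_int :: int \<Rightarrow> 'b" by (rule ring_morphism_of_int)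
  let ?g = "\<lambda>d. root_poly (mset_set (primitive_roots d :: 'b set))"
  let ?D = "{d. d dvd n} - {n}"
  have n: "n > 0" using less.prems by (cases n) auto
  have split: "(\<Prod>d | d dvd n. g d) = (\<Prod>d\<in>?D. g d) * g n" for g :: "nat \<Rightarrow> 'b poly"
    using n by (subst prod.remove[of _ n]) (auto simp: mult.commute)
  have IH: "cyclotomic d = ?g d" if "d \<in> ?D" for d
  proof (rule less.IH)
    show "d < n" using that n by (auto dest: dvd_imp_le)
    show "of_nat d \<noteq> (0 :: 'b)" using that less.prems by (auto elim!: dvdE)
  qed
  have "(\<Prod>d | d dvd n. cyclotomic d) = (Polynomial.monom 1 n - 1 :: 'b poly)"
    unfolding cyclotomic_def map_poly_hom_prod[symmetric] prod_cyclotomic_int[OF n]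
    by (simp add: map_poly_hom_diff map_poly_monom)
  also have "\<dots> = (\<Prod>d | d dvd n. ?g d)" using prod_primitive_roots[OF less.prems] by simp
  finally have "(\<Prod>d\<in>?D. ?g d) * cyclotomic n = (\<Prod>d\<in>?D. ?g d) * ?g n"
    unfolding split using IH by simp
  moreover have "(\<Prod>d\<in>?D. ?g d) \<noteq> 0" using n by simp
  ultimately show ?case by (metis mult_left_cancel)
qed

lemma ac_roots_cyclotomic:
  assumes "of_nat n \<noteq> (0 :: 'a::field)"
  shows "ac_roots (cyclotomic n :: 'a poly) = mset_set (primitive_roots n)"
proof -
  have "map_poly to_ac (cyclotomic n :: 'a poly) = cyclotomic n"
    unfolding cyclotomic_def by (subst map_poly_map_poly) (simp_all add: o_def)
  moreover have "of_nat n \<noteq> (0 :: 'a alg_closure)"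
    using assms by (metis to_ac_eq_0_iff to_ac_of_nat)
  ultimately show ?thesis by (simp add: ac_roots_def cyclotomic_alg_closed)
qed

lemma cyclotomic_monic:
  assumes "n > 0"
  shows "Polynomial.lead_coeff (cyclotomic n :: 'a::field poly) = 1"
  unfolding cyclotomic_def
  by (rule ring_morphism.map_poly_hom_monic[OF ring_morphism_of_int cyclotomic_int_monic[OF assms]])

section \<open>Products of primitive roots of coprime orders\<close>

lemma pow_eq_pow_mod_order:
  assumes "z \<in> primitive_roots n" "[k = l] (mod n)"
  shows "z ^ k = (z::'b::field) ^ l"
proof -
  have "z ^ k = z ^ (k mod n)" for k
  proof -
    have "z ^ k = z ^ (n * (k div n) + k mod n)" by simp
    also have "\<dots> = z ^ (k mod n)" using assms(1)
      by (simp only: power_add power_mult primitive_rootsD[THEN iffD2] dvd_refl) simp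
    finally show ?thesis .
  qed
  then show ?thesis using assms(2) by (metis cong_def)
qed

text \<open>Raising \<open>(a * b) ^ k = 1\<close> to the power \<open>n\<close> removes
  \<open>b\<close>, so \<open>m\<close> divides \<open>k * n\<close> and, by coprimality,
  \<open>k\<close>. The same with the roles exchanged shows that \<open>n\<close> divides
  \<open>k\<close>.\<close>

lemma primitive_roots_mult:
  fixes a b :: "'b::field"
  assumes cop: "coprime m n" and a: "a \<in> primitive_roots m" and b: "b \<in> primitive_roots n"
  shows "a * b \<in> primitive_roots (m * n)"
proof -
  have pos: "m > 0" "n > 0" using a b by (auto simp: primitive_roots_def)
  have "m * n dvd k" if k: "(a * b) ^ k = 1" for k
  proof -
    have "a ^ (k * n) = (a * b) ^ (k * n)"
      using b by (simp add: power_mult_distrib primitive_rootsD)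
    then have "m dvd k * n" using k a by (simp add: power_mult primitive_rootsD[symmetric])
    moreover have "b ^ (k * m) = (a * b) ^ (k * m)"
      using a by (simp add: power_mult_distrib primitive_rootsD)
    then have "n dvd k * m" using k b by (simp add: power_mult primitive_rootsD[symmetric])
    ultimately show ?thesis using cop
      by (simp add: coprime_dvd_mult_left_iff coprime_commute divides_mult)
  qed
  moreover have "(a * b) ^ k = 1" if "m * n dvd k" for k
  proof -
    have "m dvd k" "n dvd k" using that dvd_mult_left dvd_mult_right by blast+
    then show ?thesis
      by (simp add: power_mult_distrib primitive_rootsD[OF a, THEN iffD2] primitive_rootsD[OF b, THEN iffD2])
  qed
  ultimately show ?thesis using pos by (auto simp: primitive_roots_def)
qed

text \<open>The Chinese remainder theorem supplies exponents \<open>u\<close> and \<open>v\<close>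
  that act as projections: the inverse map sends \<open>z\<close> to the pair of
  \<open>z ^ u\<close> and \<open>z ^ v\<close>.\<close>

lemma bij_betw_primitive_roots_mult:
  assumes cop: "coprime m n" and pos: "m > 0" "n > 0"
  shows "bij_betw (\<lambda>(a, b). a * b) (primitive_roots m \<times> primitive_roots n)
    (primitive_roots (m * n) :: 'b::field set)"
  unfolding bij_betw_def
proof
  obtain u where u: "[u = 1] (mod m)" "[u = 0] (mod n)"
    using binary_chinese_remainder_nat[OF cop] by blast
  obtain v where v: "[v = 0] (mod m)" "[v = 1] (mod n)"
    using binary_chinese_remainder_nat[OF cop] by blast
  have "[u + v = 1 + 0] (mod m)" "[u + v = 0 + 1] (mod n)" using u v by (intro cong_add; simp)+
  then have uv: "[u + v = 1] (mod (m * n))"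
    using cop by (simp add: coprime_cong_mult_nat)
  show "inj_on (\<lambda>(a, b). a * b) (primitive_roots m \<times> primitive_roots n :: ('b \<times> 'b) set)"
  proof (rule inj_onI, clarify)
    fix a b c d :: 'b
    assume a: "a \<in> primitive_roots m" and b: "b \<in> primitive_roots n"
      and c: "c \<in> primitive_roots m" and d: "d \<in> primitive_roots n" and eq: "a * b = c * d"
    have *: "x = (x * y) ^ u \<and> y = (x * y) ^ v"
      if "x \<in> primitive_roots m" "y \<in> primitive_roots n" for x y :: 'b
      using pow_eq_pow_mod_order[OF that(1) u(1)] pow_eq_pow_mod_order[OF that(2) u(2)]
        pow_eq_pow_mod_order[OF that(1) v(1)] pow_eq_pow_mod_order[OF that(2) v(2)]
      by (simp add: power_mult_distrib)
    show "a = c \<and> b = d" using *[OF a b] *[OF c d] eq by simp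
  qed
  show "(\<lambda>(a, b). a * b) ` (primitive_roots m \<times> primitive_roots n) = (primitive_roots (m * n) :: 'b set)"
  proof (intro equalityI subsetI)
    fix z :: 'b assume z: "z \<in> primitive_roots (m * n)"
    \<comment> \<open>Used to read off the exact orders of \<open>z ^ u\<close> and
      \<open>z ^ v\<close>: \<open>u\<close> is a multiple of \<open>n\<close> coprime to
      \<open>m\<close>, so \<open>m * n\<close> divides \<open>u * k\<close> just when
      \<open>m\<close> divides \<open>k\<close>; similarly for \<open>v\<close>.\<close>
    have aux: "c * d dvd w * k \<longleftrightarrow> c dvd k" if w: "coprime w c" "d dvd w" "d > 0" for c d w k :: nat
    proof -
      obtain w' where w': "w = d * w'" using w(2) by (elim dvdE)
      then have "coprime c w'" using w(1) by (simp add: coprime_commute)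
      then show ?thesis using w(3) by (simp add: w' mult.assoc mult.commute[of c] coprime_dvd_mult_right_iff)
    qed
    have cop': "coprime u m" "coprime v n" using u v
      by (metis cong_imp_coprime cong_sym coprime_1_left)+
    have dvd: "n dvd u" "m dvd v" using u v by (simp_all add: cong_0_iff)
    have "m * n dvd u * k \<longleftrightarrow> m dvd k" "m * n dvd v * k \<longleftrightarrow> n dvd k" for k
      using aux[OF cop'(1) dvd(1) pos(2), of k] aux[OF cop'(2) dvd(2) pos(1), of k]
      by (simp_all add: mult.commute)
    then have "z ^ u \<in> primitive_roots m" "z ^ v \<in> primitive_roots n"
      using z pos by (auto simp: primitive_roots_def power_mult[symmetric])
    moreover have "z = z ^ u * z ^ v"
      using pow_eq_pow_mod_order[OF z uv] by (simp add: power_add)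
    ultimately show "z \<in> (\<lambda>(a, b). a * b) ` (primitive_roots m \<times> primitive_roots n)"
      by (force intro: rev_image_eqI)
  qed (auto intro: primitive_roots_mult[OF cop])
qed

subsection \<open>The Frobenius map\<close>

definition frob :: "'a::finite_field alg_closure \<Rightarrow> 'a alg_closure" where
  "frob x = x ^ card (UNIV :: 'a set)"

lemma card_finite_field_gt_1: "card (UNIV :: 'a::finite_field set) > 1"
proof -
  have "card {0, 1 :: 'a} \<le> card (UNIV :: 'a set)" by (intro card_mono) auto
  then show ?thesis by simp
qed

lemma frob_power: "(frob ^^ k) (x :: 'a::finite_field alg_closure) = x ^ (card (UNIV :: 'a set) ^ k)"
  by (induction k) (simp_all add: frob_def power_mult[symmetric] mult.commute)

lemma frob_to_ac [simp]: "frob (to_ac x) = to_ac x"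
  by (simp add: frob_def finite_field_power_card_eq_same flip: to_ac_power)

text \<open>The fixed points are the roots of \<open>X ^ q - X\<close>, at most \<open>q\<close> in
  number, and the embedded base field already provides \<open>q\<close> of them.\<close>

lemma frob_fixed_iff: "frob x = x \<longleftrightarrow> x \<in> range to_ac"
  for x :: "'a::finite_field alg_closure"
proof -
  let ?q = "card (UNIV :: 'a set)"
  let ?p = "Polynomial.monom 1 ?q - [:0, 1:] :: 'a alg_closure poly"
  have q: "?q > 1" by (rule card_finite_field_gt_1)
  have deg: "Polynomial.degree ?p \<le> ?q" using q by (intro degree_diff_le) (auto simp: degree_monom_le)
  have "coeff ?p ?q = 1" using q by (cases ?q) (auto simp: coeff_pCons split: nat.splits)
  then have p0: "?p \<noteq> 0" by force
  have roots: "{x. poly ?p x = 0} = {x :: 'a alg_closure. frob x = x}"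
    by (simp add: poly_monom frob_def)
  have fin: "finite {x :: 'a alg_closure. frob x = x}"
    using poly_roots_finite[OF p0] unfolding roots .
  have "range to_ac = {x :: 'a alg_closure. frob x = x}"
  proof (rule card_seteq[OF fin])
    have "card {x :: 'a alg_closure. frob x = x} \<le> ?q"
      using card_poly_roots_bound[OF p0] deg unfolding roots by linarith
    then show "card {x :: 'a alg_closure. frob x = x} \<le> card (range (to_ac :: 'a \<Rightarrow> _))"
      by (simp add: card_image[OF inj_to_ac])
  qed auto
  then show ?thesis by blast
qed

text \<open>The polynomial \<open>(X + 1) ^ q - X ^ q - 1\<close> has degree less than \<open>q\<close> but vanishes on the \<open>q\<close>
  elements of the base field, so it is zero.\<close>
lemma frob_add_1: "frob (x + 1) = frob x + (1 :: 'a::finite_field alg_closure)"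
proof -
  let ?q = "card (UNIV :: 'a set)"
  let ?p = "[:1, 1:] ^ ?q - Polynomial.monom 1 ?q - 1 :: 'a alg_closure poly"
  have q: "?q > 1" by (rule card_finite_field_gt_1)
  have "?p = 0"
  proof (rule ccontr)
    assume p0: "?p \<noteq> 0"
    have deg1: "Polynomial.degree ([:1, 1:] ^ ?q :: 'a alg_closure poly) = ?q"
      by (simp add: degree_power_eq)
    have "Polynomial.lead_coeff ([:1, 1:] ^ ?q :: 'a alg_closure poly) = 1"
      by (simp add: lead_coeff_power)
    then have "coeff ?p ?q = 0" using q deg1 by simp
    moreover have "Polynomial.degree ?p \<le> ?q"
      by (intro degree_diff_le) (auto simp: deg1 degree_monom_le)
    ultimately have "Polynomial.degree ?p < ?q"
      using p0 eq_zero_or_degree_less by blast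
    moreover have "poly ?p (to_ac a) = 0" for a :: 'a
    proof -
      have "poly ?p (to_ac a) = frob (to_ac (1 + a)) - frob (to_ac a) - 1"
        by (simp add: poly_monom frob_def del: frob_to_ac)
      then show ?thesis by (simp only: frob_to_ac) simp
    qed
    then have "range to_ac \<subseteq> {x. poly ?p x = 0}" by blast
    then have "?q \<le> card {x. poly ?p x = 0}"
      using card_mono[OF poly_roots_finite[OF p0]] by (metis card_image[OF inj_to_ac])
    then have "?q \<le> Polynomial.degree ?p" using card_poly_roots_bound[OF p0] by linarith
    ultimately show False by simp
  qed
  then have "poly ?p x = 0" by simp
  then show ?thesis by (simp add: frob_def poly_monom poly_power algebra_simps)
qed

text \<open>For nonzero \<open>y\<close>, additivity follows from \<open>frob_add_1\<close> by
  writing \<open>x + y\<close> as \<open>y * (x / y + 1)\<close> and using multiplicativity.\<close>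

lemma ring_morphism_frob: "ring_morphism (frob :: 'a::finite_field alg_closure \<Rightarrow> _)"
proof
  show "frob (x * y) = frob x * frob y" for x y :: "'a alg_closure"
    by (simp add: frob_def power_mult_distrib)
  then show "frob (x + y) = frob x + frob y" for x y :: "'a alg_closure"
  proof (cases "y = 0")
    case False
    have "frob (x + y) = frob (y * (x / y + 1))" using False by (simp add: field_simps)
    also have "\<dots> = frob (y * (x / y)) + frob y"
      unfolding \<open>\<And>x y. frob (x * y) = _\<close> frob_add_1 by (simp add: algebra_simps)
    finally show ?thesis using False by simp
  qed (simp add: frob_def card_gt_0_iff)
qed (simp add: frob_def)

text \<open>Translation by 1 permutes the field, so adding 1 to every element leaves the sum of all
  elements unchanged.\<close>

lemma of_nat_card_finite_field: "of_nat (card (UNIV :: 'a set)) = (0 :: 'a::finite_field)"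
proof -
  have "(\<Sum>x\<in>(UNIV :: 'a set). x + 1) = (\<Sum>x\<in>UNIV. x)"
    by (rule sum.reindex_bij_witness[of _ "\<lambda>x. x - 1" "\<lambda>x. x + 1"]) auto
  then show ?thesis by (simp add: sum.distrib)
qed

lemma of_nat_nonzero_finite_field:
  assumes "coprime n (card (UNIV :: 'a set))"
  shows "of_nat n \<noteq> (0 :: 'a::finite_field)"
proof
  assume "of_nat n = (0 :: 'a)"
  then have "CHAR('a) dvd n" by (simp add: of_nat_eq_0_iff_char_dvd)
  moreover have "CHAR('a) dvd card (UNIV :: 'a set)"
    using of_nat_card_finite_field[where 'a = 'a] by (simp add: of_nat_eq_0_iff_char_dvd)
  ultimately have "CHAR('a) dvd 1" using assms coprime_common_divisor by blast
  then show False using CHAR_prime[where 'a = 'a] by simp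
qed

section \<open>Monic polynomials over a finite field and Frobenius-stable multisets\<close>

lemma root_poly_ac_roots:
  assumes "Polynomial.lead_coeff f = 1"
  shows "root_poly (ac_roots f) = map_poly to_ac f"
  unfolding ac_roots_def
  by (rule root_poly_proots, rule ring_morphism.map_poly_hom_monic[OF ring_morphism_to_ac assms])

text \<open>Applying \<open>frob\<close> to the coefficients changes nothing, as they lie in the
  base field, but it replaces each root by its image.\<close>

lemma frob_ac_roots:
  fixes f :: "'a::finite_field poly"
  assumes "Polynomial.lead_coeff f = 1"
  shows "image_mset frob (ac_roots f) = ac_roots f"
proof -
  have "root_poly (image_mset frob (ac_roots f)) = map_poly frob (map_poly to_ac f)"
    using assms by (simp add: map_poly_root_poly[OF ring_morphism_frob] flip: root_poly_ac_roots)
  also have "\<dots> = map_poly to_ac f"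
    by (intro poly_eqI) (simp add: coeff_map_poly frob_def[of 0] card_gt_0_iff)
  also have "\<dots> = root_poly (ac_roots f)" using assms by (simp add: root_poly_ac_roots)
  finally show ?thesis by (metis proots_root_poly)
qed

lemma monic_eqI:
  assumes "Polynomial.lead_coeff f = 1" "Polynomial.lead_coeff g = 1" "ac_roots f = ac_roots g"
  shows "f = g"
proof -
  have "map_poly to_ac f = map_poly to_ac g"
    using assms by (metis root_poly_ac_roots)
  then show ?thesis by (rule map_poly_inject[OF inj_to_ac to_ac_0])
qed

lemma ac_roots_mult:
  assumes "f \<noteq> 0" "g \<noteq> 0"
  shows "ac_roots (f * g) = ac_roots f + ac_roots g"
proof -
  have "map_poly to_ac f \<noteq> 0" "map_poly to_ac g \<noteq> 0"
    using assms by (auto simp: map_poly_eq_0_iff)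
  then show ?thesis
    by (simp add: ac_roots_def ring_morphism.map_poly_hom_mult[OF ring_morphism_to_ac] proots_mult)
qed

lemma ac_roots_prod:
  assumes "\<And>i. i \<in> I \<Longrightarrow> f i \<noteq> 0"
  shows "ac_roots (\<Prod>i\<in>I. f i) = (\<Sum>i\<in>I. ac_roots (f i))"
  using assms by (induction I rule: infinite_finite_induct) (auto simp: ac_roots_mult, simp_all add: ac_roots_def)

lemma size_ac_roots:
  assumes "Polynomial.lead_coeff f = 1"
  shows "size (ac_roots f) = Polynomial.degree f"
proof -
  have "Polynomial.degree (root_poly A) = size A" for A :: "'a alg_closure multiset"
    by (induction A) (simp_all del: mult_pCons_left add: degree_mult_eq)
  then show ?thesis
    using ring_morphism.map_poly_hom_monic(2)[OF ring_morphism_to_ac assms] assms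
    by (metis root_poly_ac_roots)
qed

definition from_roots :: "'a::field alg_closure multiset \<Rightarrow> 'a poly" where
  "from_roots A = map_poly of_ac (root_poly A)"

text \<open>Stability of the roots makes the coefficients fixed points of \<open>frob\<close>, hence
  elements of the base field by \<open>frob_fixed_iff\<close>; there \<open>to_ac\<close> undoes
  \<open>of_ac\<close>.\<close>

lemma from_roots:
  fixes A :: "'a::finite_field alg_closure multiset"
  assumes "image_mset frob A = A"
  shows "Polynomial.lead_coeff (from_roots A) = 1" "ac_roots (from_roots A) = A"
proof -
  have "map_poly frob (root_poly A) = root_poly A"
    using assms by (simp add: map_poly_root_poly[OF ring_morphism_frob])
  then have "frob (coeff (root_poly A) k) = coeff (root_poly A) k" for k
    by (metis coeff_map_poly ring_morphism.hom_zero ring_morphism_frob)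
  then have *: "to_ac (of_ac (coeff (root_poly A) k)) = coeff (root_poly A) k" for k
    by (intro to_ac_of_ac) (simp add: frob_fixed_iff)
  have eq: "map_poly to_ac (from_roots A) = root_poly A"
    by (intro poly_eqI) (simp add: from_roots_def coeff_map_poly *)
  then show "ac_roots (from_roots A) = A" by (simp add: ac_roots_def)
  have "Polynomial.degree (from_roots A) = Polynomial.degree (root_poly A)"
    unfolding from_roots_def by (rule map_poly_degree_eq) simp
  then show "Polynomial.lead_coeff (from_roots A) = 1"
    by (simp add: from_roots_def coeff_map_poly)
qed

subsection \<open>Composed multiplication as a product of multisets\<close>

definition mset_times :: "'b::comm_monoid_mult multiset \<Rightarrow> 'b multiset \<Rightarrow> 'b multiset" where
  "mset_times A B = (\<Sum>a\<in>#A. image_mset ((*) a) B)"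

lemma mset_times_empty [simp]: "mset_times {#} B = {#}" "mset_times A {#} = {#}"
  by (simp_all add: mset_times_def)

lemma mset_times_add_mset [simp]:
  "mset_times (add_mset a A) B = image_mset ((*) a) B + mset_times A B"
  by (simp add: mset_times_def)

lemma mset_times_add_left: "mset_times (A + A') B = mset_times A B + mset_times A' B"
  by (simp add: mset_times_def)

lemma mset_times_add_right: "mset_times A (B + B') = mset_times A B + mset_times A B'"
  by (induction A) simp_all

lemma mset_times_sum_left: "mset_times (\<Sum>i\<in>I. A i) B = (\<Sum>i\<in>I. mset_times (A i) B)"
  by (induction I rule: infinite_finite_induct) (simp_all add: mset_times_add_left)

lemma mset_times_sum_right: "mset_times A (\<Sum>i\<in>I. B i) = (\<Sum>i\<in>I. mset_times A (B i))"
  by (induction I rule: infinite_finite_induct) (simp_all add: mset_times_add_right)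

lemma mset_times_1_left [simp]: "mset_times {#1#} B = B"
  by (induction B) simp_all

lemma mset_times_1_right [simp]: "mset_times A {#1#} = A"
  by (induction A) simp_all

lemma image_mset_times_mset_times:
  "image_mset ((*) a) (mset_times B C) = mset_times (image_mset ((*) a) B) C"
proof -
  have "(*) (a * b) = (\<lambda>c. a * (b * c))" for b by (simp add: fun_eq_iff mult.assoc)
  then show ?thesis by (induction B) (simp_all add: multiset.map_comp o_def)
qed

lemma mset_times_assoc: "mset_times (mset_times A B) C = mset_times A (mset_times B C)"
  by (induction A) (simp_all add: mset_times_add_left image_mset_times_mset_times)

lemma set_mset_times: "set_mset (mset_times A B) = (\<lambda>(a, b). a * b) ` (set_mset A \<times> set_mset B)"
  by (induction A) auto

lemma image_mset_mset_times:
  assumes "\<And>x y. h (x * y) = h x * h y"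
  shows "image_mset h (mset_times A B) = mset_times (image_mset h A) (image_mset h B)"
  by (induction A) (simp_all add: multiset.map_comp o_def assms)

lemma mset_times_mset_set:
  assumes "finite A" "finite B"
  shows "mset_times (mset_set A) (mset_set B) = image_mset (\<lambda>(a, b). a * b) (mset_set (A \<times> B))"
  using assms(1)
proof (induction A)
  case (insert a A)
  have "insert a A \<times> B = Pair a ` B \<union> A \<times> B" by auto
  moreover have "mset_set (Pair a ` B \<union> A \<times> B) = mset_set (Pair a ` B) + mset_set (A \<times> B)"
    using insert assms(2) by (intro mset_set_Union) auto
  moreover have "mset_set (Pair a ` B) = image_mset (Pair a) (mset_set B)"
    by (simp add: image_mset_mset_set inj_on_def)
  ultimately show ?case using insert by (simp add: multiset.map_comp o_def)
qed simp

lemma mset_times_primitive_roots: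
  assumes "coprime m n" "m > 0" "n > 0"
  shows "mset_times (mset_set (primitive_roots m)) (mset_set (primitive_roots n :: 'b::field set)) =
    mset_set (primitive_roots (m * n))"
  using bij_betw_primitive_roots_mult[OF assms, where 'b = 'b]
  by (simp add: mset_times_mset_set image_mset_mset_set bij_betw_def)

lemma composed_mult_eq: "composed_mult f g = from_roots (mset_times (ac_roots f) (ac_roots g))"
proof -
  have "(\<Prod>\<alpha>\<in>#A. \<Prod>\<beta>\<in>#B. [:- (\<alpha> * \<beta>), 1:]) = root_poly (mset_times A B)"
    for A B :: "'a alg_closure multiset"
    by (induction A) (simp_all add: root_poly_union, simp add: root_poly_def multiset.map_comp o_def)
  then show ?thesis by (simp add: composed_mult_def from_roots_def)
qed

text \<open>Since \<open>frob\<close> is multiplicative, a product of stable multisets is stable, so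
  the composed product really descends to the base field.\<close>

lemma composed_mult:
  fixes f g :: "'a::finite_field poly"
  assumes "Polynomial.lead_coeff f = 1" "Polynomial.lead_coeff g = 1"
  shows "Polynomial.lead_coeff (composed_mult f g) = 1"
    and "ac_roots (composed_mult f g) = mset_times (ac_roots f) (ac_roots g)"
  unfolding composed_mult_eq using assms
  by (auto intro!: from_roots simp: image_mset_mset_times frob_ac_roots
    ring_morphism.hom_mult[OF ring_morphism_frob])

lemma ac_roots_X_minus_1 [simp]: "ac_roots [:- 1, 1:] = {#1#}"
  by (simp add: ac_roots_def map_poly_pCons)

text \<open>The fold always ends in \<open>{#1#}\<close>, the roots of \<open>X - 1\<close>, whereas
  \<open>composed_mult_list\<close> stops at a singleton; both agree because \<open>{#1#}\<close> is
  neutral.\<close>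

lemma composed_mult_list:
  fixes fs :: "'a::finite_field poly list"
  assumes "\<forall>f\<in>set fs. Polynomial.lead_coeff f = 1"
  shows "Polynomial.lead_coeff (composed_mult_list fs) = 1"
    and "ac_roots (composed_mult_list fs) = foldr mset_times (map ac_roots fs) {#1#}"
proof -
  have "Polynomial.lead_coeff (composed_mult_list fs) = 1 \<and>
      ac_roots (composed_mult_list fs) = foldr mset_times (map ac_roots fs) {#1#}"
    using assms by (induction fs rule: composed_mult_list.induct) (simp_all add: composed_mult)
  then show "Polynomial.lead_coeff (composed_mult_list fs) = 1"
    "ac_roots (composed_mult_list fs) = foldr mset_times (map ac_roots fs) {#1#}" by auto
qed

text \<open>Associativity splits off the last factor although \<open>foldr\<close> works from the
  front; inductions along \<open>[0..<Suc k]\<close> need this.\<close>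

lemma foldr_mset_times: "foldr mset_times As B = mset_times (foldr mset_times As {#1#}) B"
  by (induction As) (simp_all add: mset_times_assoc del: mset_times_add_mset)

lemma foldr_mset_times_upt_Suc:
  "foldr mset_times (map A [0..<Suc k]) {#1#} = mset_times (foldr mset_times (map A [0..<k]) {#1#}) (A k)"
  using foldr_mset_times[of _ "A k"] by simp

text \<open>Distributivity: a product of sums expands into a sum over all choice functions.\<close>

lemma foldr_mset_times_sum:
  "foldr mset_times (map (\<lambda>i. \<Sum>j<r i. B i j) [0..<s]) {#1#} =
    (\<Sum>J\<in>(\<Pi>\<^sub>E i\<in>{..<s}. {..<r i::nat}). foldr mset_times (map (\<lambda>i. B i (J i)) [0..<s]) {#1#})"
proof (induction s)
  case (Suc s)
  let ?F = "\<lambda>J s. foldr mset_times (map (\<lambda>i. B i (J i)) [0..<s]) {#1#}"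
  have F: "?F (J(s := j)) s = ?F J s" for J j
    by (intro arg_cong[where f = "\<lambda>As. foldr mset_times As {#1#}"] map_cong) auto
  \<comment> \<open>A choice function below \<open>Suc s\<close> is the same as its value
    \<open>j\<close> at \<open>s\<close> together with a choice function \<open>J\<close> below
    \<open>s\<close>.\<close>
  let ?h = "\<lambda>(j, J). J(s := j)"
  have "(\<Pi>\<^sub>E i\<in>{..<Suc s}. {..<r i}) = ?h ` ({..<r s} \<times> (\<Pi>\<^sub>E i\<in>{..<s}. {..<r i}))"
    by (simp add: lessThan_Suc PiE_insert_eq)
  moreover have "inj_on ?h ({..<r s} \<times> (\<Pi>\<^sub>E i\<in>{..<s}. {..<r i}))"
    by (rule inj_combinator) simp
  ultimately have "(\<Sum>J\<in>(\<Pi>\<^sub>E i\<in>{..<Suc s}. {..<r i}). ?F J (Suc s)) =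
      (\<Sum>(j, J)\<in>{..<r s} \<times> (\<Pi>\<^sub>E i\<in>{..<s}. {..<r i}). ?F (J(s := j)) (Suc s))"
    by (simp only: sum.reindex) (simp add: case_prod_beta o_def)
  also have "\<dots> = (\<Sum>j<r s. \<Sum>J\<in>(\<Pi>\<^sub>E i\<in>{..<s}. {..<r i}). mset_times (?F J s) (B s j))"
    unfolding foldr_mset_times_upt_Suc F by (simp add: sum.cartesian_product)
  also have "\<dots> = mset_times (\<Sum>J\<in>(\<Pi>\<^sub>E i\<in>{..<s}. {..<r i}). ?F J s) (\<Sum>j<r s. B s j)"
    by (simp only: mset_times_sum_left mset_times_sum_right)
  finally show ?case unfolding foldr_mset_times_upt_Suc Suc.IH by (rule sym)
qed simp


subsection \<open>Irreducibility and Frobenius orbits\<close>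

text \<open>This holds of the empty multiset and ignores multiplicities; nonemptiness and simple
  roots enter the irreducibility criterion separately.\<close>

definition conjugate_roots :: "'a::finite_field alg_closure multiset \<Rightarrow> bool" where
  "conjugate_roots A \<longleftrightarrow> (\<forall>\<alpha>\<in>#A. \<forall>\<beta>\<in>#A. \<exists>k. \<beta> = (frob ^^ k) \<alpha>)"

lemma inj_frob: "inj (frob :: 'a::finite_field alg_closure \<Rightarrow> _)"
proof (rule injI)
  interpret ring_morphism "frob :: 'a alg_closure \<Rightarrow> _" by (rule ring_morphism_frob)
  fix x y :: "'a alg_closure" assume "frob x = frob y"
  then have "frob (x + - y) = 0" by (simp only: hom_add hom_uminus) simp
  then show "x = y" by (simp add: frob_def)
qed

lemma frob_stable_funpow:
  assumes "image_mset frob A = A" "\<alpha> \<in># A"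
  shows "(frob ^^ k) \<alpha> \<in># A"
proof (induction k)
  case (Suc k)
  then have "frob ((frob ^^ k) \<alpha>) \<in># image_mset frob A" by (simp only: set_image_mset imageI)
  then show ?case using assms(1) by simp
qed (use assms(2) in simp)

lemma is_unit_monic_iff:
  assumes "Polynomial.lead_coeff f = 1"
  shows "is_unit (f :: 'a::field poly) \<longleftrightarrow> ac_roots f = {#}"
proof -
  have "is_unit f \<longleftrightarrow> Polynomial.degree f = 0"
    using assms by (metis is_unit_iff_degree coeff_0 zero_neq_one)
  then show ?thesis using size_ac_roots[OF assms] by (metis size_eq_0_iff_empty)
qed

lemma monic_associate:
  fixes g :: "'a::field poly"
  assumes "g \<noteq> 0"
  obtains c g' where "c \<noteq> 0" "g = Polynomial.smult c g'" "Polynomial.lead_coeff g' = 1"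
proof
  show "Polynomial.lead_coeff g \<noteq> 0" using assms by simp
  then show "g = Polynomial.smult (Polynomial.lead_coeff g) (Polynomial.smult (inverse (Polynomial.lead_coeff g)) g)"
    "Polynomial.lead_coeff (Polynomial.smult (inverse (Polynomial.lead_coeff g)) g) = 1"
    by simp_all
qed

text \<open>The Frobenius orbit of a root is stable, so it is the root set of a nonconstant factor
  over the base field. Irreducibility leaves no further roots.\<close>

lemma irreducible_conjugate_roots:
  fixes f :: "'a::finite_field poly"
  assumes monic: "Polynomial.lead_coeff f = 1" and irr: "Factorial_Ring.irreducible f"
  shows "ac_roots f \<noteq> {#}" "conjugate_roots (ac_roots f)"
proof -
  show "ac_roots f \<noteq> {#}"
    using irr is_unit_monic_iff[OF monic] by (auto dest: Factorial_Ring.irreducible_not_unit)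
  have stable: "image_mset frob (ac_roots f) = ac_roots f" by (rule frob_ac_roots[OF monic])
  show "conjugate_roots (ac_roots f)" unfolding conjugate_roots_def
  proof (intro ballI)
    fix \<alpha> \<beta> assume \<alpha>: "\<alpha> \<in># ac_roots f" and \<beta>: "\<beta> \<in># ac_roots f"
    let ?O = "range (\<lambda>k. (frob ^^ k) \<alpha>)"
    have sub: "?O \<subseteq> set_mset (ac_roots f)" using frob_stable_funpow[OF stable \<alpha>] by blast
    then have fin: "finite ?O" by (rule finite_subset) simp
    have inj: "inj_on frob ?O" by (rule inj_on_subset[OF inj_frob]) simp
    \<comment> \<open>The orbit uses forward iterates only, so stability needs an argument: an
      injective self-map of a finite set is onto.\<close>
    have "frob ` ?O = ?O"
    proof (rule endo_inj_surj[OF fin _ inj])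
      have "frob ((frob ^^ k) \<alpha>) = (frob ^^ Suc k) \<alpha>" for k by simp
      then show "frob ` ?O \<subseteq> ?O" by blast
    qed
    then have stO: "image_mset frob (mset_set ?O) = mset_set ?O"
      using inj by (simp add: image_mset_mset_set)
    define C where "C = ac_roots f - mset_set ?O"
    have subm: "mset_set ?O \<subseteq># ac_roots f"
    proof (rule mset_subset_eqI)
      show "count (mset_set ?O) x \<le> count (ac_roots f) x" for x
        using sub fin by (cases "x \<in> ?O") (auto simp: Suc_le_eq)
    qed
    then have C: "mset_set ?O + C = ac_roots f" by (simp add: C_def)
    have stC: "image_mset frob C = C"
      unfolding C_def by (simp add: image_mset_Diff[OF subm] stable stO)
    note O = from_roots[OF stO] and C' = from_roots[OF stC]
    have nz: "from_roots (mset_set ?O) \<noteq> 0" "from_roots C \<noteq> 0" using O C' by auto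
    have f: "f = from_roots (mset_set ?O) * from_roots C"
    proof (rule monic_eqI[OF monic])
      show "Polynomial.lead_coeff (from_roots (mset_set ?O) * from_roots C) = 1"
        by (simp only: lead_coeff_mult O(1) C'(1) mult_1_right)
      show "ac_roots f = ac_roots (from_roots (mset_set ?O) * from_roots C)"
        unfolding ac_roots_mult[OF nz] O(2) C'(2) C ..
    qed
    have "\<not> is_unit (from_roots (mset_set ?O))"
      using is_unit_monic_iff[OF O(1)] O(2) fin by (auto simp: mset_set_empty_iff)
    then have "is_unit (from_roots C)" using irr f by (metis Factorial_Ring.irreducibleD)
    then have "C = {#}" using is_unit_monic_iff[OF C'(1)] C'(2) by simp
    then have "\<beta> \<in># mset_set ?O" using \<beta> C by simp
    then show "\<exists>k. \<beta> = (frob ^^ k) \<alpha>" using fin by auto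
  qed
qed

text \<open>If both factors of \<open>f\<close> had roots, some iterate of \<open>frob\<close> would
  carry a root of one to a root of the other. By stability the latter would be a root of both
  factors, hence a multiple root of \<open>f\<close>.\<close>

lemma irreducibleI_conjugate_roots:
  fixes f :: "'a::finite_field poly"
  assumes monic: "Polynomial.lead_coeff f = 1" and ne: "ac_roots f \<noteq> {#}"
    and conj: "conjugate_roots (ac_roots f)" and dist: "\<And>\<alpha>. count (ac_roots f) \<alpha> \<le> 1"
  shows "Factorial_Ring.irreducible f"
proof (rule Factorial_Ring.irreducibleI)
  show f0: "f \<noteq> 0" using monic by auto
  show "\<not> is_unit f" using ne is_unit_monic_iff[OF monic] by simp
  fix g h assume f: "f = g * h"
  have "g \<noteq> 0" "h \<noteq> 0" using f f0 by auto
  \<comment> \<open>The factors need not be monic, but stability of the roots is known for monic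
    polynomials; the split-off constants have product 1.\<close>
  obtain c g' where g: "c \<noteq> 0" "g = Polynomial.smult c g'" "Polynomial.lead_coeff g' = 1"
    using monic_associate[OF \<open>g \<noteq> 0\<close>] .
  obtain d h' where h: "d \<noteq> 0" "h = Polynomial.smult d h'" "Polynomial.lead_coeff h' = 1"
    using monic_associate[OF \<open>h \<noteq> 0\<close>] .
  have "Polynomial.lead_coeff (g * h) = c * d"
    by (simp only: lead_coeff_mult g(2) h(2) lead_coeff_smult g(3) h(3) mult_1_right)
  then have "c * d = 1" using monic f by simp
  then have f': "f = g' * h'" using f g(2) h(2) by (simp add: mult.commute)
  have roots: "ac_roots f = ac_roots g' + ac_roots h'"
    unfolding f' using g(3) h(3) by (intro ac_roots_mult) auto
  have "ac_roots g' = {#} \<or> ac_roots h' = {#}"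
  proof (rule ccontr)
    assume "\<not> ?thesis"
    then obtain \<alpha> \<beta> where \<alpha>: "\<alpha> \<in># ac_roots g'" and \<beta>: "\<beta> \<in># ac_roots h'"
      by (meson multiset_nonemptyE)
    then obtain k where k: "\<beta> = (frob ^^ k) \<alpha>"
      using conj roots by (auto simp: conjugate_roots_def)
    have "\<beta> \<in># ac_roots g'"
      unfolding k by (rule frob_stable_funpow[OF frob_ac_roots[OF g(3)] \<alpha>])
    then have "count (ac_roots f) \<beta> \<ge> 2"
      using \<beta> unfolding roots by (simp add: Suc_le_eq flip: count_greater_zero_iff)
    then show False using dist[of \<beta>] by simp
  qed
  then have "is_unit g' \<or> is_unit h'" using is_unit_monic_iff g(3) h(3) by blast
  then show "is_unit g \<or> is_unit h" using g(1,2) h(1,2) by (auto simp: is_unit_smult_iff dvd_field_iff)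
qed

lemma funpow_frob_mult: "(frob ^^ k) (x * y) = (frob ^^ k) x * (frob ^^ k) y"
  by (simp add: frob_power power_mult_distrib)

lemma funpow_frob_cong:
  assumes "(frob ^^ d) x = x" "[k = l] (mod d)"
  shows "(frob ^^ k) x = (frob ^^ l) x"
proof -
  have "(frob ^^ k) x = (frob ^^ (k mod d)) x" for k
    using funpow_mod_eq[OF assms(1)] by metis
  then show ?thesis using assms(2) by (metis cong_def)
qed

text \<open>On \<open>A\<close> only the exponent modulo \<open>c\<close> matters and on
  \<open>B\<close> only that modulo \<open>d\<close>, so one exponent \<open>m\<close> achieves both
  conjugations at once. The second claim passes on a period, so that further factors can be
  multiplied in.\<close>

lemma conjugate_roots_mset_times:
  assumes A: "conjugate_roots A" "\<And>\<alpha>. \<alpha> \<in># A \<Longrightarrow> (frob ^^ c) \<alpha> = \<alpha>"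
    and B: "conjugate_roots B" "\<And>\<beta>. \<beta> \<in># B \<Longrightarrow> (frob ^^ d) \<beta> = \<beta>"
    and cop: "coprime c d"
  shows "conjugate_roots (mset_times A B)"
    and "\<And>\<gamma>. \<gamma> \<in># mset_times A B \<Longrightarrow> (frob ^^ (c * d)) \<gamma> = \<gamma>"
proof -
  show "conjugate_roots (mset_times A B)"
    unfolding conjugate_roots_def set_mset_times
  proof clarsimp
    fix a b a' b' assume a: "a \<in># A" "b \<in># B" "a' \<in># A" "b' \<in># B"
    then obtain k l where k: "a' = (frob ^^ k) a" and l: "b' = (frob ^^ l) b"
      using A(1) B(1) unfolding conjugate_roots_def by blast
    obtain m where "[m = k] (mod c)" "[m = l] (mod d)"
      using binary_chinese_remainder_nat[OF cop] by blast
    then have "a' * b' = (frob ^^ m) (a * b)"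
      using funpow_frob_cong[OF A(2)] funpow_frob_cong[OF B(2)] a k l by (simp add: funpow_frob_mult)
    then show "\<exists>m. a' * b' = (frob ^^ m) (a * b)" ..
  qed
  fix \<gamma> assume "\<gamma> \<in># mset_times A B"
  then obtain a b where \<gamma>: "a \<in># A" "b \<in># B" "\<gamma> = a * b" by (auto simp: set_mset_times)
  have "(frob ^^ (c * d)) a = (frob ^^ 0) a" "(frob ^^ (c * d)) b = (frob ^^ 0) b"
    using funpow_frob_cong[OF A(2)[OF \<gamma>(1)], of "c * d" 0] funpow_frob_cong[OF B(2)[OF \<gamma>(2)], of "c * d" 0]
    by (simp_all add: cong_0_iff)
  then show "(frob ^^ (c * d)) \<gamma> = \<gamma>" by (simp add: \<gamma> funpow_frob_mult)
qed

text \<open>Iterating \<open>frob\<close> raises \<open>z\<close> to a power of \<open>q\<close>,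
  and \<open>q ^ ord m q\<close> is 1 modulo the order \<open>m\<close> of \<open>z\<close>.\<close>

lemma frob_ord_primitive_root:
  fixes z :: "'a::finite_field alg_closure"
  assumes "z \<in> primitive_roots m"
  shows "(frob ^^ ord m (card (UNIV :: 'a set))) z = z"
  using pow_eq_pow_mod_order[OF assms ord_works[of "card (UNIV :: 'a set)" m, THEN conjunct1]]
  by (simp add: frob_power)

lemma mset_times_mono:
  assumes "A \<subseteq># A'" "B \<subseteq># B'"
  shows "mset_times A B \<subseteq># mset_times A' B'"
proof -
  obtain C D where "A' = A + C" "B' = B + D" using assms by (metis subset_mset.le_iff_add)
  then show ?thesis by (simp add: mset_times_add_left mset_times_add_right add.assoc)
qed

lemma coprime_prime_powers:
  assumes "inj_on p {..<s}" "\<And>i. i < s \<Longrightarrow> Factorial_Ring.prime (p i :: nat)" "i < s" "j < s" "i \<noteq> j"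
  shows "coprime (p i ^ e i) (p j ^ e j)"
  using assms by (auto intro!: coprime_power_left_iff[THEN iffD2] coprime_power_right_iff[THEN iffD2]
    primes_coprime dest: inj_onD)

lemma foldr_mset_times_primitive_roots:
  assumes "\<And>i. i < s \<Longrightarrow> m i > (0::nat)"
    and "\<And>i j. i < s \<Longrightarrow> j < s \<Longrightarrow> i \<noteq> j \<Longrightarrow> coprime (m i) (m j)"
  shows "foldr mset_times (map (\<lambda>i. mset_set (primitive_roots (m i) :: 'b::field set)) [0..<s]) {#1#} =
    mset_set (primitive_roots (\<Prod>i<s. m i))"
  using assms
proof (induction s)
  case (Suc s)
  have "coprime (\<Prod>i<s. m i) (m s)" using Suc.prems(2) by (intro prod_coprime_left) auto
  then show ?case unfolding foldr_mset_times_upt_Suc using Suc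
    by (simp add: mset_times_primitive_roots prod_pos)
qed simp

subsection \<open>Factorization of cyclotomic polynomials\<close>

theorem theorem3p1:
  fixes q n s :: nat
    and p e r :: "nat \<Rightarrow> nat"
    and f :: "nat \<Rightarrow> nat \<Rightarrow> 'a :: finite_field poly"
  assumes "q = card (UNIV :: 'a set)"
    and "inj_on p {..<s}"
    and "\<And>i. i < s \<Longrightarrow> Factorial_Ring.prime (p i)"
    and "\<And>i. i < s \<Longrightarrow> e i > 0"
    and "n = (\<Prod>i<s. p i ^ e i)"
    and "gcd n q = 1"
    and "\<And>i j. i < s \<Longrightarrow> j < r i \<Longrightarrow>
           Polynomial.lead_coeff (f i j) = 1 \<and> Factorial_Ring.irreducible (f i j)"
    and "\<And>i. i < s \<Longrightarrow> cyclotomic (p i ^ e i) = (\<Prod>j<r i. f i j)"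
  shows "cyclotomic n = composed_mult_list (map (\<lambda>i. cyclotomic (p i ^ e i) :: 'a poly) [0..<s])
       \<and> composed_mult_list (map (\<lambda>i. cyclotomic (p i ^ e i) :: 'a poly) [0..<s]) =
           (\<Prod>J \<in> (\<Pi>\<^sub>E i\<in>{..<s}. {..<r i}). composed_mult_list (map (\<lambda>i. f i (J i)) [0..<s]))
       \<and> ((\<forall>i<s. \<forall>j<s. i \<noteq> j \<longrightarrow> coprime (ord (p i ^ e i) q) (ord (p j ^ e j) q)) \<longrightarrow>
           (\<forall>J \<in> (\<Pi>\<^sub>E i\<in>{..<s}. {..<r i}).
              Factorial_Ring.irreducible (composed_mult_list (map (\<lambda>i. f i (J i)) [0..<s]))))"
proof -
  define m where "m = (\<lambda>i. p i ^ e i)"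
  define M where "M = (\<lambda>k. \<Prod>i<k. m i)"
  have m_pos: "m i > 0" if "i < s" for i
    using assms(3)[OF that] by (simp add: m_def prime_gt_0_nat)
  have cop: "coprime (m i) (m j)" if "i < s" "j < s" "i \<noteq> j" for i j
    unfolding m_def using coprime_prime_powers[OF assms(2,3) that] .
  have M_pos: "M k > 0" if "k \<le> s" for k
    unfolding M_def using m_pos that by (intro prod_pos) auto
  have cop_M: "coprime (M k) (m k)" if "k < s" for k
    unfolding M_def using cop that by (intro prod_coprime_left) auto
  have n: "n = M s" by (simp add: M_def m_def assms(5))
  have n_q: "coprime n (card (UNIV :: 'a set))"
    using assms(6) unfolding assms(1) by (rule gcd_eq_1_imp_coprime)
  have m_q: "of_nat (m i) \<noteq> (0 :: 'a)" if "i < s" for i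
  proof (rule of_nat_nonzero_finite_field)
    have "m i dvd n" using that by (auto simp: n M_def)
    then show "coprime (m i) (card (UNIV :: 'a set))" using n_q by (rule coprime_divisors[OF _ dvd_refl])
  qed
  let ?\<Phi> = "map (\<lambda>i. cyclotomic (p i ^ e i) :: 'a poly) [0..<s]"
  let ?f = "\<lambda>J. map (\<lambda>i. f i (J i)) [0..<s]"
  let ?\<Pi> = "\<Pi>\<^sub>E i\<in>{..<s}. {..<r i}"
  let ?prod = "\<lambda>A k. foldr mset_times (map A [0..<k]) {#1#} :: 'a alg_closure multiset"

  have \<Phi>_monic: "\<forall>g\<in>set ?\<Phi>. Polynomial.lead_coeff g = 1"
    using m_pos by (auto simp: m_def intro!: cyclotomic_monic)
  have f_monic: "Polynomial.lead_coeff (f i j) = 1" and f_irr: "Factorial_Ring.irreducible (f i j)"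
    if "i < s" "j < r i" for i j using assms(7)[OF that] by auto
  have J: "J i < r i" if "J \<in> ?\<Pi>" "i < s" for i J using that by (auto simp: PiE_iff)
  have fs_monic: "\<forall>g\<in>set (?f J). Polynomial.lead_coeff g = 1" if "J \<in> ?\<Pi>" for J
    using that J by (auto intro: f_monic)
  have \<Phi>_roots: "ac_roots (cyclotomic (p i ^ e i) :: 'a poly) = mset_set (primitive_roots (m i))"
    if "i < s" for i
    using ac_roots_cyclotomic[OF m_q[OF that]] by (simp add: m_def)
  \<comment> \<open>Besides the second equation, this serves irreducibility: the roots of each
    \<open>f i j\<close> are primitive roots of order \<open>m i\<close> and are simple.\<close>
  have \<Phi>_split: "mset_set (primitive_roots (m i)) = (\<Sum>j<r i. ac_roots (f i j))" if i: "i < s" for i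
  proof -
    have "f i j \<noteq> 0" if "j < r i" for j using f_monic[OF i that] by auto
    then show ?thesis unfolding \<Phi>_roots[OF i, symmetric] assms(8)[OF i] by (intro ac_roots_prod) auto
  qed
  have roots_f: "ac_roots (composed_mult_list (?f J)) = ?prod (\<lambda>i. ac_roots (f i (J i))) s"
    if "J \<in> ?\<Pi>" for J
    unfolding composed_mult_list(2)[of "?f J", OF fs_monic[OF that]] by (simp add: o_def)
  have "ac_roots (composed_mult_list ?\<Phi>) = ?prod (\<lambda>i. ac_roots (cyclotomic (p i ^ e i) :: 'a poly)) s"
    unfolding composed_mult_list(2)[of ?\<Phi>, OF \<Phi>_monic] by (simp add: o_def)
  also have "\<dots> = ?prod (\<lambda>i. mset_set (primitive_roots (m i))) s"
    by (intro arg_cong[where f = "\<lambda>As. foldr mset_times As {#1#}"] map_cong) (auto simp: \<Phi>_roots)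
  finally have roots_\<Phi>: "ac_roots (composed_mult_list ?\<Phi>) = ?prod (\<lambda>i. mset_set (primitive_roots (m i))) s" .
  have \<Phi>_lc: "Polynomial.lead_coeff (composed_mult_list ?\<Phi>) = 1"
    by (rule composed_mult_list(1)[OF \<Phi>_monic])

  have 1: "cyclotomic n = composed_mult_list ?\<Phi>"
  proof (rule monic_eqI[OF cyclotomic_monic \<Phi>_lc])
    show "n > 0" using M_pos n by simp
    show "ac_roots (cyclotomic n :: 'a poly) = ac_roots (composed_mult_list ?\<Phi>)"
      unfolding ac_roots_cyclotomic[OF of_nat_nonzero_finite_field[OF n_q]] unfolding roots_\<Phi> n M_def
      using m_pos cop by (rule foldr_mset_times_primitive_roots[symmetric])
  qed

  have 2: "composed_mult_list ?\<Phi> = (\<Prod>J\<in>?\<Pi>. composed_mult_list (?f J))"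
  proof (rule monic_eqI[OF \<Phi>_lc])
    have lc: "Polynomial.lead_coeff (composed_mult_list (?f J)) = 1" if "J \<in> ?\<Pi>" for J
      by (rule composed_mult_list(1)[OF fs_monic[OF that]])
    then show "Polynomial.lead_coeff (\<Prod>J\<in>?\<Pi>. composed_mult_list (?f J)) = 1"
      by (simp add: lead_coeff_prod)
    have "ac_roots (composed_mult_list ?\<Phi>) = ?prod (\<lambda>i. \<Sum>j<r i. ac_roots (f i j)) s"
      unfolding roots_\<Phi>
      by (intro arg_cong[where f = "\<lambda>As. foldr mset_times As {#1#}"] map_cong) (auto simp: \<Phi>_split)
    also have "\<dots> = (\<Sum>J\<in>?\<Pi>. ac_roots (composed_mult_list (?f J)))"
      by (simp add: foldr_mset_times_sum roots_f)
    also have "\<dots> = ac_roots (\<Prod>J\<in>?\<Pi>. composed_mult_list (?f J))"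
      using lc by (intro ac_roots_prod[symmetric]) force
    finally show "ac_roots (composed_mult_list ?\<Phi>) = ac_roots (\<Prod>J\<in>?\<Pi>. composed_mult_list (?f J))" .
  qed

  have 3: "Factorial_Ring.irreducible (composed_mult_list (?f J))"
    if ord: "\<forall>i<s. \<forall>j<s. i \<noteq> j \<longrightarrow> coprime (ord (p i ^ e i) q) (ord (p j ^ e j) q)"
      and JP: "J \<in> ?\<Pi>" for J
  proof -
    define A where "A = (\<lambda>i. ac_roots (f i (J i)))"
    define d where "d = (\<lambda>i. ord (m i) q)"
    have A_sub: "A i \<subseteq># mset_set (primitive_roots (m i))" if "i < s" for i
      unfolding A_def \<Phi>_split[OF that] using J[OF JP that] by (subst sum.remove[of _ "J i"]) auto
    have A_fix: "(frob ^^ d i) \<alpha> = \<alpha>" if "i < s" "\<alpha> \<in># A i" for i \<alpha>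
      using mset_subset_eqD[OF A_sub[OF that(1)] that(2)]
      unfolding d_def assms(1) by (intro frob_ord_primitive_root) simp
    have A_conj: "A i \<noteq> {#}" "conjugate_roots (A i)" if "i < s" for i
      unfolding A_def using irreducible_conjugate_roots[OF f_monic f_irr, OF that J[OF JP that] that J[OF JP that]] .
    \<comment> \<open>The invariant: nonempty, a single orbit, simple roots (by inclusion in a set
      of primitive roots), and a period, the product of the \<open>d i\<close>, which is coprime to
      the next \<open>d k\<close>.\<close>
    have "?prod A k \<noteq> {#} \<and> conjugate_roots (?prod A k) \<and>
        ?prod A k \<subseteq># mset_set (primitive_roots (M k)) \<and>
        (\<forall>\<alpha>\<in>#?prod A k. (frob ^^ (\<Prod>i<k. d i)) \<alpha> = \<alpha>)" if "k \<le> s" for k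
      using that
    proof (induction k)
      case 0
      \<comment> \<open>The empty product is \<open>{#1#}\<close>, \<open>M 0\<close> is 1, and 1 is
        the only primitive root of order 1.\<close>
      show ?case by (simp add: conjugate_roots_def M_def frob_power frob_def)
    next
      case (Suc k)
      then have k: "k < s" and IH: "?prod A k \<noteq> {#}" "conjugate_roots (?prod A k)"
        "?prod A k \<subseteq># mset_set (primitive_roots (M k))"
        "\<And>\<alpha>. \<alpha> \<in># ?prod A k \<Longrightarrow> (frob ^^ (\<Prod>i<k. d i)) \<alpha> = \<alpha>" by auto
      have "coprime (\<Prod>i<k. d i) (d k)"
        using ord k by (intro prod_coprime_left) (auto simp: d_def m_def)
      note * = conjugate_roots_mset_times[OF IH(2,4) A_conj(2)[OF k] A_fix[OF k] this]
      have "mset_times (?prod A k) (A k) \<noteq> {#}"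
        using IH(1) A_conj(1)[OF k] by (simp flip: set_mset_eq_empty_iff add: set_mset_times)
      moreover have "mset_times (?prod A k) (A k) \<subseteq># mset_set (primitive_roots (M (Suc k)))"
        using mset_times_mono[OF IH(3) A_sub[OF k]] cop_M[OF k] M_pos[of k] m_pos[OF k] k
        by (simp add: mset_times_primitive_roots M_def)
      ultimately show ?case unfolding foldr_mset_times_upt_Suc using * by simp
    qed
    from this[of s] have P: "?prod A s \<noteq> {#}" "conjugate_roots (?prod A s)"
      "?prod A s \<subseteq># mset_set (primitive_roots (M s))" by auto
    show ?thesis
    proof (rule irreducibleI_conjugate_roots)
      show "Polynomial.lead_coeff (composed_mult_list (?f J)) = 1"
        by (rule composed_mult_list(1)[OF fs_monic[OF JP]])
      show "ac_roots (composed_mult_list (?f J)) \<noteq> {#}" "conjugate_roots (ac_roots (composed_mult_list (?f J)))"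
        using P(1,2) by (simp_all add: roots_f[OF JP] A_def)
      \<comment> \<open>Inclusion in a \<open>mset_set\<close> bounds every multiplicity by
        1.\<close>
      show "count (ac_roots (composed_mult_list (?f J))) \<alpha> \<le> 1" for \<alpha>
        using mset_subset_eq_count[OF P(3), of \<alpha>]
        by (simp add: roots_f[OF JP] A_def count_mset_set' split: if_splits)
    qed
  qed
  from 1 2 3 show ?thesis by blast
qed

end
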